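(* There exists $\tilde\kappa_1>0$ such that for every $\kappa\in(\tilde\kappa_1,4/e)$ there exist positive constants $C,\beta$ independent of $\varepsilon$ and $p$, such that for every $p\in\mathbb N$ and every $\varepsilon\in(0,1]$ there exists a ReLU NN $\Phi^{\exp,\kappa,p}_\varepsilon$ (with one-dimensional input and output) with $$\varepsilon^{1/2}\big\|-\tfrac1\varepsilon\exp(-\cdot/\varepsilon)-\mathrm R(\Phi^{\exp,\kappa,p}_\varepsilon)'\big\|_{L^2((0,1))}\le Ce^{-\beta p},$$ $$\|\exp(-\cdot/\varepsilon)-\mathrm R(\Phi^{\exp,\kappa,p}_\varepsilon)\|_{L^2((0,1))}\le Ce^{-\beta p},$$ $$\|\exp(-\cdot/\varepsilon)-\mathrm R(\Phi^{\exp,\kappa,p}_\varepsilon)\|_{L^\infty((0,1))}\le Ce^{-\beta p}.$$ For a constant $\tilde C=\tilde C(\beta)>0$ depending only on $\beta$, the NN depth and size satisfy $$L(\Phi^{\exp,\kappa,p}_\varepsilon)\le\tilde Cp(1+\log_2(p)),\qquad M(\Phi^{\exp,\kappa,p}_\varepsilon)\le\tilde Cp^2.$$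
   Context: Neural networks (NNs): for $d,L\in\mathbb N$, a NN with input dimension $d$ and $L$ layers is a finite sequence $\Phi=((A_1,b_1),\dots,(A_L,b_L))$ with $N_0=d$, $N_1,\dots,N_L\in\mathbb N$, $A_\ell\in\mathbb R^{N_\ell\times N_{\ell-1}}$, $b_\ell\in\mathbb R^{N_\ell}$. For an activation $\varrho:\mathbb R\to\mathbb R$ (applied componentwise) its realization is $\mathrm R(\Phi):\mathbb R^d\to\mathbb R^{N_L}$, $x\mapsto x_L$, where $x_0=x$, $x_\ell=\varrho(A_\ell x_{\ell-1}+b_\ell)$ for $\ell=1,\dots,L-1$, and $x_L=A_Lx_{L-1}+b_L$. The depth is $L(\Phi)=L$ and the size is $M(\Phi)=\sum_{\ell=1}^L(\|A_\ell\|_0+\|b_\ell\|_0)$, where $\|\cdot\|_0$ counts nonzero entries. A ReLU NN uses only the activation $\rho(x)=\max\{0,x\}$. *)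

theory Defs
  imports "HOL-Analysis.Analysis" "HOL-Probability.Essential_Supremum" "Jordan_Normal_Form.Matrix"
begin

section \<open>Neural networks\<close>

type_synonym network = "(real mat \<times> real Matrix.vec) list"

text \<open>The witness \<open>N\<close> is the sequence of layer widths; the \<open>l\<close>-th list entry (counted from 0)
  is the pair of weight matrix and bias of layer \<open>l + 1\<close>.\<close>

definition is_network :: "nat \<Rightarrow> nat \<Rightarrow> network \<Rightarrow> bool" where
  "is_network d n \<Phi> \<longleftrightarrow> \<Phi> \<noteq> [] \<and>
     (\<exists>N :: nat \<Rightarrow> nat. N 0 = d \<and> N (length \<Phi>) = n \<and> (\<forall>l \<le> length \<Phi>. 1 \<le> N l) \<and>
        (\<forall>l < length \<Phi>. fst (\<Phi> ! l) \<in> carrier_mat (N (Suc l)) (N l) \<and>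
                         snd (\<Phi> ! l) \<in> carrier_vec (N (Suc l))))"

text \<open>The activation is applied after every layer except the last. The value on the empty list is
  immaterial, since \<open>is_network\<close> excludes it.\<close>

fun realization :: "(real \<Rightarrow> real) \<Rightarrow> network \<Rightarrow> real Matrix.vec \<Rightarrow> real Matrix.vec" where
  "realization \<rho> [] x = x"
| "realization \<rho> [(A, b)] x = A *\<^sub>v x + b"
| "realization \<rho> ((A, b) # layer # \<Phi>) x =
     realization \<rho> (layer # \<Phi>) (map_vec \<rho> (A *\<^sub>v x + b))"

definition relu :: "real \<Rightarrow> real" where
  "relu x = max 0 x"

definition depth :: "network \<Rightarrow> nat" where
  "depth \<Phi> = length \<Phi>"

definition nnz_mat :: "real mat \<Rightarrow> nat" where
  "nnz_mat A = card {(i, j). i < dim_row A \<and> j < dim_col A \<and> A $$ (i, j) \<noteq> 0}"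

definition nnz_vec :: "real Matrix.vec \<Rightarrow> nat" where
  "nnz_vec b = card {i. i < dim_vec b \<and> vec_index b i \<noteq> 0}"

definition network_size :: "network \<Rightarrow> nat" where
  "network_size \<Phi> = (\<Sum>(A, b)\<leftarrow>\<Phi>. nnz_mat A + nnz_vec b)"

text \<open>The realization of a ReLU network with one-dimensional input and output, as a function on
  the reals. It is continuous and piecewise affine, so it is differentiable off a finite set and
  its weak derivative is represented by \<open>deriv\<close>, whose unspecified values on that finite set do
  not affect any norm below.\<close>

definition relu_fun :: "network \<Rightarrow> real \<Rightarrow> real" where
  "relu_fun \<Phi> x = vec_index (realization relu \<Phi> (Matrix.vec 1 (\<lambda>_. x))) 0"

section \<open>Lebesgue norms\<close>

text \<open>The norms take values in the extended nonnegative reals, with value \<open>\<infinity>\<close> on functions outside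
  the space (including nonmeasurable ones), so that a finite bound asserts membership as well.\<close>

definition L2_norm :: "real set \<Rightarrow> (real \<Rightarrow> real) \<Rightarrow> ennreal" where
  "L2_norm S f =
     (let I = \<integral>\<^sup>+x. ennreal ((f x)\<^sup>2) \<partial>lebesgue_on S
      in if f \<in> borel_measurable (lebesgue_on S) \<and> I < \<infinity> then ennreal (sqrt (enn2real I)) else \<infinity>)"

definition Linf_norm :: "real set \<Rightarrow> (real \<Rightarrow> real) \<Rightarrow> ennreal" where
  "Linf_norm S f =
     (if f \<in> borel_measurable (lebesgue_on S)
      then esssup (lebesgue_on S) (\<lambda>x. ennreal \<bar>f x\<bar>) else \<infinity>)"

end

(* The target is e^(-H) E(max 0 (H - x/eps)), where E interpolates exp linearly at the grid hZ.
   On a grid cell both E and its slope lie between the extreme values of exp there, so each differs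
   from exp by at most the factor e^h - 1; clipping at H costs e^(-H). With h = 2^(-p) and H = 2^p this
   is exponentially accurate in p, uniformly in eps after rescaling.
   The network computes E exactly. Folding the argument, w' = |w - b| with b running through the
   halves, quarters, ... of [0, H], brings it into the first cell in O(p) steps, where E(w) and E(-w)
   are affine. Conversely E(w) and E(-w) are e^b E(w - b) and e^(-b) E(b - w), where w - b is w' or -w'.
   The selection between the two is continuous because E(w') - E(-w') vanishes at w' = 0: it is at
   most K w' for some K, so subtracting max 0 (E(w') - E(-w') - K max 0 (w - b)) selects exactly.
   Remembering the O(p) values max 0 (w - b) needs width O(p), hence size O(p^2). *)

theory Submission
  imports Defs
begin

section \<open>Sparse layers\<close>

lemma relu_nonneg [simp]: "0 \<le> x \<Longrightarrow> relu x = x"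
  by (simp add: relu_def)

lemma relu_idem [simp]: "relu (relu x) = relu x"
  by (simp add: relu_def)

text \<open>Row \<open>i\<close> is a list of pairs (column, weight), with repeated columns adding
  up. A layer then acts by short sums, and the length of a row list bounds its number of nonzero
  weights.\<close>

definition sparse_layer ::
  "nat \<Rightarrow> nat \<Rightarrow> (nat \<Rightarrow> (nat \<times> real) list) \<Rightarrow> (nat \<Rightarrow> real) \<Rightarrow> real mat \<times> real Matrix.vec" where
  "sparse_layer n c ws bias =
     (Matrix.mat n c (\<lambda>(i, j). \<Sum>(k, a)\<leftarrow>ws i. if k = j then a else 0), Matrix.vec n bias)"

definition apply_layer :: "real mat \<times> real Matrix.vec \<Rightarrow> real Matrix.vec \<Rightarrow> real Matrix.vec" where
  "apply_layer L x = fst L *\<^sub>v x + snd L"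

text \<open>Here the activation follows every layer, the last included. As a fold this splits along
  concatenation, so blocks of layers can be evaluated separately.\<close>

definition hidden_layers :: "(real \<Rightarrow> real) \<Rightarrow> network \<Rightarrow> real Matrix.vec \<Rightarrow> real Matrix.vec" where
  "hidden_layers \<rho> = fold (\<lambda>L x. map_vec \<rho> (apply_layer L x))"

lemma hidden_layers_Nil [simp]: "hidden_layers \<rho> [] x = x"
  by (simp add: hidden_layers_def)

lemma hidden_layers_Cons [simp]:
  "hidden_layers \<rho> (L # \<Phi>) x = hidden_layers \<rho> \<Phi> (map_vec \<rho> (apply_layer L x))"
  by (simp add: hidden_layers_def)

lemma hidden_layers_append [simp]:
  "hidden_layers \<rho> (\<Phi> @ \<Psi>) x = hidden_layers \<rho> \<Psi> (hidden_layers \<rho> \<Phi> x)"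
  by (simp add: hidden_layers_def)

text \<open>Since \<open>\<Phi> @ [L]\<close> has a nonempty tail behind each layer of
  \<open>\<Phi>\<close>, the recursion of \<open>realization\<close> activates all of these and
  leaves only \<open>L\<close> affine.\<close>

lemma realization_snoc:
  "realization \<rho> (\<Phi> @ [L]) x = apply_layer L (hidden_layers \<rho> \<Phi> x)"
proof (induction \<Phi> arbitrary: x)
  case Nil
  then show ?case by (cases L) (simp add: hidden_layers_def apply_layer_def)
next
  case (Cons P \<Phi>)
  obtain A b where P: "P = (A, b)" by (cases P)
  obtain Q \<Psi> where Q: "\<Phi> @ [L] = Q # \<Psi>" by (cases "\<Phi> @ [L]") auto
  have "realization \<rho> ((P # \<Phi>) @ [L]) x = realization \<rho> (\<Phi> @ [L]) (map_vec \<rho> (A *\<^sub>v x + b))"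
    by (simp add: P Q)
  also have "\<dots> = apply_layer L (hidden_layers \<rho> (P # \<Phi>) x)"
    by (simp only: Cons.IH) (simp add: hidden_layers_def apply_layer_def P)
  finally show ?case .
qed

lemma sparse_layer_carrier:
  "fst (sparse_layer n c ws bias) \<in> carrier_mat n c"
  "snd (sparse_layer n c ws bias) \<in> carrier_vec n"
  by (simp_all add: sparse_layer_def)

lemma sum_sparse_row:
  fixes v :: "nat \<Rightarrow> real"
  assumes "\<forall>(k, a)\<in>set xs. k < c"
  shows "(\<Sum>j = 0..<c. (\<Sum>(k, a)\<leftarrow>xs. if k = j then a else 0) * v j) = (\<Sum>(k, a)\<leftarrow>xs. a * v k)"
  using assms
proof (induction xs)
  case Nil
  then show ?case by simp
next
  case (Cons y ys)
  obtain k a where y: "y = (k, a)" by (cases y)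
  have k: "k < c" using Cons.prems y by auto
  have "(\<Sum>j = 0..<c. (if k = j then a else 0) * v j) = (\<Sum>j = 0..<c. if j = k then a * v k else 0)"
    by (rule sum.cong) auto
  also have "\<dots> = a * v k" using k by simp
  finally show ?case using Cons by (simp add: y distrib_right sum.distrib)
qed

lemma apply_sparse_layer:
  assumes "\<And>i k a. i < n \<Longrightarrow> (k, a) \<in> set (ws i) \<Longrightarrow> k < c"
  shows "apply_layer (sparse_layer n c ws bias) (Matrix.vec c v) =
    Matrix.vec n (\<lambda>i. (\<Sum>(k, a)\<leftarrow>ws i. a * v k) + bias i)"
proof -
  have "(\<Sum>j = 0..<c. (\<Sum>(k, a)\<leftarrow>ws i. if k = j then a else 0) * v j)
      = (\<Sum>(k, a)\<leftarrow>ws i. a * v k)" if "i < n" for i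
    by (rule sum_sparse_row) (use assms that in auto)
  then show ?thesis
    by (intro eq_vecI)
      (simp_all add: apply_layer_def sparse_layer_def scalar_prod_def)
qed

text \<open>Reduces the correctness of a hidden layer to one scalar identity per register.\<close>

lemma relu_sparse_layer:
  assumes "\<And>i k a. i < n \<Longrightarrow> (k, a) \<in> set (ws i) \<Longrightarrow> k < c"
    and "\<And>i. i < n \<Longrightarrow> relu ((\<Sum>(k, a)\<leftarrow>ws i. a * v k) + bias i) = u i"
  shows "map_vec relu (apply_layer (sparse_layer n c ws bias) (Matrix.vec c v)) = Matrix.vec n u"
  using assms by (simp add: apply_sparse_layer) (intro eq_vecI; simp)

section \<open>Counting nonzero weights\<close>

lemma card_sparse_row:
  "card {j. (\<Sum>(k, a)\<leftarrow>xs. if k = j then a else 0 :: real) \<noteq> 0} \<le> length xs"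
  "finite {j. (\<Sum>(k, a)\<leftarrow>xs. if k = j then a else 0 :: real) \<noteq> 0}"
proof -
  have zero: "(\<Sum>(k, a)\<leftarrow>xs. if k = j then a else 0 :: real) = 0" if "j \<notin> fst ` set xs" for j
    using that by (induction xs) auto
  have sub: "{j. (\<Sum>(k, a)\<leftarrow>xs. if k = j then a else 0 :: real) \<noteq> 0} \<subseteq> fst ` set xs"
    using zero by blast
  show "finite {j. (\<Sum>(k, a)\<leftarrow>xs. if k = j then a else 0 :: real) \<noteq> 0}"
    by (rule finite_subset[OF sub]) simp
  have "card {j. (\<Sum>(k, a)\<leftarrow>xs. if k = j then a else 0 :: real) \<noteq> 0} \<le> card (fst ` set xs)"
    by (rule card_mono[OF _ sub]) simp
  also have "\<dots> \<le> card (set xs)" by (rule card_image_le) simp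
  also have "\<dots> \<le> length xs" by (rule card_length)
  finally show "card {j. (\<Sum>(k, a)\<leftarrow>xs. if k = j then a else 0 :: real) \<noteq> 0} \<le> length xs" .
qed

text \<open>Each of the \<open>n\<close> rows has at most \<open>s\<close> nonzero weights and one
  bias. The bound is independent of the number \<open>c\<close> of columns, which keeps a layer
  linear in its width.\<close>

lemma network_size_sparse_layer:
  assumes "\<And>i. i < n \<Longrightarrow> length (ws i) \<le> s"
  shows "network_size [sparse_layer n c ws bias] \<le> n * (s + 1)"
proof -
  define A where "A = (\<lambda>i j. \<Sum>(k, a)\<leftarrow>ws i. if k = j then a else 0 :: real)"
  have "nnz_mat (fst (sparse_layer n c ws bias)) \<le> card (SIGMA i:{..<n}. {j. A i j \<noteq> 0})"
    unfolding nnz_mat_def sparse_layer_def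
    by (rule card_mono) (auto simp: A_def card_sparse_row(2) intro!: finite_SigmaI)
  also have "\<dots> = (\<Sum>i<n. card {j. A i j \<noteq> 0})"
    by (rule card_SigmaI) (auto simp: A_def card_sparse_row(2))
  also have "\<dots> \<le> (\<Sum>i<n. s)"
    unfolding A_def by (intro sum_mono order_trans[OF card_sparse_row(1)]) (use assms in simp)
  finally have mat: "nnz_mat (fst (sparse_layer n c ws bias)) \<le> n * s" by simp
  have "nnz_vec (snd (sparse_layer n c ws bias)) \<le> card {..<n}"
    unfolding nnz_vec_def sparse_layer_def by (rule card_mono) auto
  with mat show ?thesis
    by (simp add: network_size_def case_prod_beta)
qed

lemma network_size_append: "network_size (\<Phi> @ \<Psi>) = network_size \<Phi> + network_size \<Psi>"
  by (simp add: network_size_def)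

lemma network_size_map_le:
  assumes "\<And>k. k \<in> set ks \<Longrightarrow> network_size [f k] \<le> s"
  shows "network_size (map f ks) \<le> length ks * s"
  using assms
proof (induction ks)
  case Nil
  then show ?case by (simp add: network_size_def)
next
  case (Cons k ks)
  have "network_size (map f (k # ks)) = network_size [f k] + network_size (map f ks)"
    by (simp add: network_size_def)
  also have "\<dots> \<le> s + length ks * s"
    using Cons by (intro add_mono) auto
  finally show ?case by simp
qed

section \<open>Widths of assembled networks\<close>

lemma is_network_sparse_layer:
  assumes "1 \<le> d" "1 \<le> n"
  shows "is_network d n [sparse_layer n d ws bias]"
  unfolding is_network_def
  by (rule conjI, simp, rule exI[of _ "\<lambda>l. if l = 0 then d else n"])
    (use assms in \<open>simp add: sparse_layer_carrier\<close>)

lemma is_network_snoc_sparse_layer: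
  assumes "is_network d c \<Phi>" "1 \<le> n"
  shows "is_network d n (\<Phi> @ [sparse_layer n c ws bias])"
proof -
  obtain N where N: "N 0 = d" "N (length \<Phi>) = c" "\<forall>l\<le>length \<Phi>. 1 \<le> N l"
    "\<forall>l<length \<Phi>. fst (\<Phi> ! l) \<in> carrier_mat (N (Suc l)) (N l) \<and> snd (\<Phi> ! l) \<in> carrier_vec (N (Suc l))"
    and ne: "\<Phi> \<noteq> []"
    using assms(1) unfolding is_network_def by blast
  have "\<forall>l<Suc (length \<Phi>).
      fst ((\<Phi> @ [sparse_layer n c ws bias]) ! l)
        \<in> carrier_mat ((N(Suc (length \<Phi>) := n)) (Suc l)) ((N(Suc (length \<Phi>) := n)) l) \<and>
      snd ((\<Phi> @ [sparse_layer n c ws bias]) ! l) \<in> carrier_vec ((N(Suc (length \<Phi>) := n)) (Suc l))"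
    using N(2,4) by (auto simp: less_Suc_eq nth_append sparse_layer_carrier)
  moreover have "\<forall>l\<le>Suc (length \<Phi>). 1 \<le> (N(Suc (length \<Phi>) := n)) l"
    using N(3) assms(2) by (auto simp: le_Suc_eq)
  ultimately show ?thesis
    unfolding is_network_def using N(1)
    by (intro conjI exI[of _ "N(Suc (length \<Phi>) := n)"]) auto
qed

lemma is_network_append_map_sparse_layer:
  assumes "is_network d n \<Phi>" "1 \<le> n"
  shows "is_network d n (\<Phi> @ map (\<lambda>k. sparse_layer n n (ws k) (bias k)) ks)"
proof (induction ks rule: rev_induct)
  case Nil
  then show ?case using assms by simp
next
  case (snoc k ks)
  then show ?case using is_network_snoc_sparse_layer[OF snoc assms(2)] by simp
qed

section \<open>Piecewise affine interpolation of the exponential\<close>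

text \<open>The interpolant E with grid hZ: the value of exp at the left end of the cell of
  \<open>t\<close>, times an affine factor rising from 1 to \<open>exp h\<close> across the
  cell.\<close>

definition exp_interp :: "real \<Rightarrow> real \<Rightarrow> real" where
  "exp_interp h t = exp (h * of_int \<lfloor>t / h\<rfloor>) * (1 + frac (t / h) * (exp h - 1))"

text \<open>On grid shifts E keeps the functional equation of exp, because the floor moves by
  \<open>n\<close> and the fractional part stays. Unfolding rests on this.\<close>

lemma exp_interp_shift:
  assumes "h > 0"
  shows "exp_interp h (t + of_int n * h) = exp (of_int n * h) * exp_interp h t"
proof -
  have "(t + of_int n * h) / h = t / h + of_int n" using assms by (simp add: field_simps)
  moreover have "frac (t / h + of_int n) = frac (t / h)" by (simp add: frac_def)
  ultimately show ?thesis
    by (simp add: exp_interp_def ring_distribs exp_add mult.commute mult.left_commute)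
qed

lemma exp_interp_bounds:
  assumes "h > 0"
  shows "exp (h * of_int \<lfloor>t / h\<rfloor>) \<le> exp_interp h t"
    and "exp_interp h t \<le> exp h * exp (h * of_int \<lfloor>t / h\<rfloor>)"
proof -
  have e: "exp h - 1 \<ge> 0" using assms by simp
  have "frac (t / h) * (exp h - 1) \<le> 1 * (exp h - 1)"
    by (rule mult_right_mono) (use e frac_lt_1[of "t / h"] in auto)
  then have 1: "1 + frac (t / h) * (exp h - 1) \<le> exp h" by simp
  have 2: "1 \<le> 1 + frac (t / h) * (exp h - 1)" using e by (simp add: frac_ge_0)
  show "exp (h * of_int \<lfloor>t / h\<rfloor>) \<le> exp_interp h t"
    unfolding exp_interp_def using mult_left_mono[OF 2, of "exp (h * of_int \<lfloor>t / h\<rfloor>)"] by simp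
  show "exp_interp h t \<le> exp h * exp (h * of_int \<lfloor>t / h\<rfloor>)"
    unfolding exp_interp_def using mult_left_mono[OF 1, of "exp (h * of_int \<lfloor>t / h\<rfloor>)"]
    by (simp add: mult.commute)
qed

lemma exp_floor_bounds:
  fixes h t :: real
  assumes "h > 0"
  shows "exp (h * of_int \<lfloor>t / h\<rfloor>) \<le> exp t" "exp t \<le> exp h * exp (h * of_int \<lfloor>t / h\<rfloor>)"
proof -
  have "real_of_int \<lfloor>t / h\<rfloor> * h \<le> t"
    using of_int_floor_le[of "t / h"] by (simp only: pos_le_divide_eq[OF assms])
  moreover have "t < (real_of_int \<lfloor>t / h\<rfloor> + 1) * h"
    by (simp only: pos_divide_less_eq[OF assms, symmetric]) linarith
  ultimately have "h * real_of_int \<lfloor>t / h\<rfloor> \<le> t" "t \<le> h + h * real_of_int \<lfloor>t / h\<rfloor>"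
    by (simp_all add: algebra_simps)
  then show "exp (h * of_int \<lfloor>t / h\<rfloor>) \<le> exp t" "exp t \<le> exp h * exp (h * of_int \<lfloor>t / h\<rfloor>)"
    by (simp_all add: exp_add[symmetric])
qed

text \<open>Two points of the interval from \<open>c\<close> to \<open>exp h * c\<close> are at most
  \<open>c * (exp h - 1)\<close> apart, and \<open>c\<close> is at most \<open>exp t\<close>. It
  serves both the values and the slopes of E.\<close>

lemma dist_exp_le_of_bounds:
  fixes h t x c :: real
  assumes "c > 0" "c \<le> x" "x \<le> exp h * c" "c \<le> exp t" "exp t \<le> exp h * c" "h > 0"
  shows "\<bar>x - exp t\<bar> \<le> exp t * (exp h - 1)"
proof -
  have "\<bar>x - exp t\<bar> \<le> c * (exp h - 1)" using assms by (simp add: algebra_simps)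
  also have "\<dots> \<le> exp t * (exp h - 1)"
    by (rule mult_right_mono) (use assms in auto)
  finally show ?thesis .
qed

lemma exp_interp_error:
  assumes "h > 0"
  shows "\<bar>exp_interp h t - exp t\<bar> \<le> exp t * (exp h - 1)"
  by (rule dist_exp_le_of_bounds[OF _ exp_interp_bounds exp_floor_bounds])
    (use assms in auto)

text \<open>The slope of the chord over the cell of \<open>t\<close>; at a grid point this is the
  right-hand derivative.\<close>

definition exp_interp_slope :: "real \<Rightarrow> real \<Rightarrow> real" where
  "exp_interp_slope h t = exp (h * of_int \<lfloor>t / h\<rfloor>) * ((exp h - 1) / h)"

lemma exp_interp_has_derivative:
  assumes "h > 0" "t / h \<notin> \<int>"
  shows "(exp_interp h has_real_derivative exp_interp_slope h t) (at t)"
proof -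
  have "((\<lambda>t. of_int \<lfloor>t / h\<rfloor> :: real) has_real_derivative 0) (at t)"
    by (rule floor_has_real_derivative) (use assms in \<open>auto intro!: continuous_intros\<close>)
  then show ?thesis
    unfolding exp_interp_def[abs_def] frac_def exp_interp_slope_def
    using assms(1) by (auto intro!: derivative_eq_intros)
qed

text \<open>The factor \<open>(exp h - 1) / h\<close> lies between 1 and \<open>exp h\<close>, by 1
  + s \<le> exp s at s = h and s = -h. So the chord slope lies in the same interval as exp on the
  cell.\<close>

lemma exp_interp_slope_error:
  assumes "h > 0"
  shows "\<bar>exp_interp_slope h t - exp t\<bar> \<le> exp t * (exp h - 1)"
proof (rule dist_exp_le_of_bounds[OF _ _ _ exp_floor_bounds])
  have "1 + - h \<le> exp (- h)" by (rule exp_ge_add_one_self)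
  then have "exp h * (1 - h) \<le> exp h * exp (- h)" by (intro mult_left_mono) auto
  then have "exp h * (1 - h) \<le> 1" by (simp add: exp_minus)
  then have "(exp h - 1) / h \<le> exp h" using assms by (simp add: field_simps)
  then show "exp_interp_slope h t \<le> exp h * exp (h * of_int \<lfloor>t / h\<rfloor>)"
    unfolding exp_interp_slope_def
    using mult_left_mono[of "(exp h - 1) / h" "exp h" "exp (h * of_int \<lfloor>t / h\<rfloor>)"]
    by (simp add: mult.commute)
  have "1 \<le> (exp h - 1) / h" using assms exp_ge_add_one_self[of h] by (simp add: field_simps)
  then show "exp (h * of_int \<lfloor>t / h\<rfloor>) \<le> exp_interp_slope h t"
    unfolding exp_interp_slope_def
    using mult_left_mono[of 1 "(exp h - 1) / h" "exp (h * of_int \<lfloor>t / h\<rfloor>)"] by simp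
qed (use assms in auto)

text \<open>The cell is closed: at \<open>w = h\<close> the floor has already jumped, but the two
  affine pieces agree there. The fully folded argument can attain this endpoint.\<close>

lemma exp_interp_pos_cell:
  assumes "h > 0" "0 \<le> w" "w \<le> h"
  shows "exp_interp h w = (exp h - 1) / h * w + 1"
proof (cases "w = h")
  case True
  then show ?thesis using assms by (simp add: exp_interp_def)
next
  case False
  then have "\<lfloor>w / h\<rfloor> = 0" using assms by (simp add: floor_eq_iff)
  then show ?thesis by (simp add: exp_interp_def frac_def)
qed

text \<open>Shifting by one cell moves \<open>- w\<close> to \<open>h - w\<close>, which is in the
  first cell again.\<close>

lemma exp_interp_neg_cell:
  assumes "h > 0" "0 \<le> w" "w \<le> h"
  shows "exp_interp h (- w) = (exp (- h) - 1) / h * w + 1"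
proof -
  have "exp_interp h (- w) = exp (- h) * exp_interp h (h - w)"
    using exp_interp_shift[OF assms(1), of "h - w" "- 1"] by simp
  also have "\<dots> = exp (- h) * ((exp h - 1) / h * (h - w) + 1)"
    using assms by (subst exp_interp_pos_cell) auto
  also have "\<dots> = (exp (- h) - 1) / h * w + 1"
    using assms by (simp add: exp_minus field_simps)
  finally show ?thesis .
qed

lemma exp_interp_ge_one: "h > 0 \<Longrightarrow> 0 \<le> w \<Longrightarrow> 1 \<le> exp_interp h w"
  by (rule order_trans[OF _ exp_interp_bounds(1)]) simp_all

lemma exp_interp_pos: "h > 0 \<Longrightarrow> 0 < exp_interp h w"
  by (rule less_le_trans[OF _ exp_interp_bounds(1)]) simp_all

text \<open>For \<open>w > 0\<close> the point \<open>- w\<close> lies in a cell of index at most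
  -1, whose right end is at most 0.\<close>

lemma exp_interp_le_one:
  assumes "h > 0" "0 \<le> w"
  shows "exp_interp h (- w) \<le> 1"
proof (cases "w = 0")
  case True
  then show ?thesis by (simp add: exp_interp_def)
next
  case False
  then have "\<lfloor>- w / h\<rfloor> \<le> - 1" using assms by (simp add: floor_le_iff divide_less_eq)
  then have "h * real_of_int \<lfloor>- w / h\<rfloor> \<le> h * (- 1)"
    by (intro mult_left_mono) (use assms in linarith)+
  then have "exp h * exp (h * of_int \<lfloor>- w / h\<rfloor>) \<le> 1"
    by (simp add: exp_add[symmetric])
  then show ?thesis using exp_interp_bounds(2)[OF assms(1), of "- w"] by linarith
qed

text \<open>Supplies the constant K of the selection. Both E(w) - 1 and 1 - E(-w) are bounded by
  \<open>exp (H + h) / h * w\<close>: in the first cell by the explicit slopes, beyond it by crude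
  bounds, as then 1 \<le> w / h.\<close>

lemma exp_interp_odd_part_le:
  assumes "h > 0" "0 \<le> w" "w \<le> H"
  shows "exp_interp h w - exp_interp h (- w) \<le> 2 * exp (H + h) / h * w"
proof -
  have H: "1 \<le> exp (H + h)" using assms by simp
  have "exp_interp h w - 1 \<le> exp (H + h) / h * w"
  proof (cases "w \<le> h")
    case True
    have "(exp h - 1) / h * w \<le> exp (H + h) / h * w"
      by (intro mult_right_mono divide_right_mono) (use assms in \<open>auto simp: add_increasing intro: order_trans[of _ "exp h"]\<close>)
    then show ?thesis using True assms by (simp add: exp_interp_pos_cell)
  next
    case False
    have "exp_interp h w \<le> exp h * exp (h * of_int \<lfloor>w / h\<rfloor>)"
      by (rule exp_interp_bounds) fact
    also have "\<dots> \<le> exp h * exp w"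
      by (intro mult_left_mono exp_floor_bounds) (use assms in auto)
    also have "\<dots> \<le> exp (H + h) * 1" using assms by (simp add: exp_add[symmetric])
    also have "\<dots> \<le> exp (H + h) * (w / h)"
      by (intro mult_left_mono) (use False assms in auto)
    finally show ?thesis by simp
  qed
  moreover have "1 - exp_interp h (- w) \<le> exp (H + h) / h * w"
  proof -
    have "1 - exp_interp h (- w) \<le> w / h"
    proof (cases "w \<le> h")
      case True
      have "(1 - exp (- h)) / h * w \<le> 1 / h * w"
        by (intro mult_right_mono divide_right_mono) (use assms in auto)
      moreover have "exp_interp h (- w) = 1 - (1 - exp (- h)) / h * w"
        using True assms by (simp add: exp_interp_neg_cell field_simps)
      ultimately show ?thesis by simp
    next
      case False
      then have "1 \<le> w / h" using assms by simp
      then show ?thesis using exp_interp_pos[OF assms(1), of "- w"] by linarith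
    qed
    also have "w / h \<le> exp (H + h) / h * w"
      using mult_right_mono[OF H, of "w / h"] assms by simp
    finally show ?thesis .
  qed
  moreover have "2 * exp (H + h) / h * w = exp (H + h) / h * w + exp (H + h) / h * w"
    by (simp add: add_divide_distrib[symmetric])
  ultimately show ?thesis by linarith
qed

section \<open>Folding\<close>

text \<open>\<open>h\<close> is the mesh width and \<open>m\<close> the number of folds; together
  they cover 2^m cells.\<close>

locale folding =
  fixes h :: real and m :: nat
  assumes h_pos: "h > 0" and m_pos: "m > 0"
begin

definition crease :: "nat \<Rightarrow> real" where
  "crease k = 2 ^ (m - Suc k) * h"

definition extent :: real where
  "extent = 2 ^ m * h"

primrec folded :: "real \<Rightarrow> nat \<Rightarrow> real" where
  "folded z 0 = z"
| "folded z (Suc k) = \<bar>folded z k - crease k\<bar>"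

definition upper :: "real \<Rightarrow> nat \<Rightarrow> real" where
  "upper z k = relu (folded z k - crease k)"

definition steep :: real where
  "steep = 2 * exp (extent + h) / h"

text \<open>The correction that selects the branch: zero above the crease, and the full difference
  E(w') - E(-w') below it.\<close>

definition gap :: "real \<Rightarrow> nat \<Rightarrow> real" where
  "gap z k = relu (exp_interp h (folded z (Suc k)) - exp_interp h (- folded z (Suc k)) - steep * upper z k)"

lemma crease_nonneg: "0 \<le> crease k"
  using h_pos by (simp add: crease_def)

lemma folded_nonneg: "0 \<le> z \<Longrightarrow> 0 \<le> folded z k"
  by (cases k) auto

text \<open>If w lies in [0, 2b], then |w - b| \<le> b, so each fold halves the range; after
  \<open>m\<close> folds one cell is left.\<close>

lemma folded_le:
  assumes "0 \<le> z" "z \<le> extent" "k \<le> m"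
  shows "folded z k \<le> 2 ^ (m - k) * h"
  using assms(3)
proof (induction k)
  case 0
  then show ?case using assms by (simp add: extent_def)
next
  case (Suc k)
  have "m - k = Suc (m - Suc k)" using Suc.prems by simp
  then have "folded z k \<le> 2 * crease k"
    using Suc by (simp add: crease_def)
  then show ?case using folded_nonneg[OF assms(1), of k] by (simp add: crease_def abs_le_iff mult.commute)
qed

text \<open>This is |t| = 2 max 0 t - t. It makes the next folded value affine in the current one
  and the remembered \<open>upper z k\<close>.\<close>

lemma folded_Suc: "folded z (Suc k) = 2 * upper z k - folded z k + crease k"
  by (cases "folded z k \<ge> crease k") (simp_all add: upper_def relu_def)

text \<open>Above the crease \<open>upper z k\<close> equals w', so the term with
  \<open>steep\<close> dominates and the gap vanishes. Below it \<open>upper z k\<close> is 0, and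
  the gap exchanges E(w') with E(-w'). The crease is a grid multiple, so the shift rule leads back
  to w.\<close>

lemma unfold_step:
  assumes z: "0 \<le> z" "z \<le> extent" and k: "k < m"
  shows "exp_interp h (folded z k) = exp (crease k) * (exp_interp h (folded z (Suc k)) - gap z k)"
    and "exp_interp h (- folded z k) = exp (- crease k) * (exp_interp h (- folded z (Suc k)) + gap z k)"
proof -
  let ?t = "folded z k - crease k"
  let ?w = "folded z (Suc k)"
  have w0: "0 \<le> ?w" using folded_nonneg[OF z(1)] .
  have "(2::real) ^ (m - Suc k) \<le> 2 ^ m" by simp
  then have "2 ^ (m - Suc k) * h \<le> extent" unfolding extent_def using h_pos by (intro mult_right_mono) auto
  then have w1: "?w \<le> extent" using folded_le[OF z, of "Suc k"] k by linarith
  have odd: "0 \<le> exp_interp h ?w - exp_interp h (- ?w)"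
    "exp_interp h ?w - exp_interp h (- ?w) \<le> steep * ?w"
    using exp_interp_ge_one[OF h_pos w0] exp_interp_le_one[OF h_pos w0]
      exp_interp_odd_part_le[OF h_pos w0 w1] by (simp_all add: steep_def)
  have t: "exp_interp h ?t = exp_interp h ?w - gap z k"
    "exp_interp h (- ?t) = exp_interp h (- ?w) + gap z k"
    using odd by (cases "?t \<ge> 0"; simp add: gap_def upper_def relu_def)+
  define n where "n = (2 ^ (m - Suc k) :: int)"
  have c: "crease k = of_int n * h" by (simp add: crease_def n_def)
  show "exp_interp h (folded z k) = exp (crease k) * (exp_interp h ?w - gap z k)"
    using exp_interp_shift[OF h_pos, of ?t n] by (simp add: c[symmetric] t)
  show "exp_interp h (- folded z k) = exp (- crease k) * (exp_interp h (- ?w) + gap z k)"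
    using exp_interp_shift[OF h_pos, of "- ?t" "- n"] unfolding t(2) by (simp add: c[symmetric])
qed

section \<open>Registers and layers of the network\<close>

lemma relu_upper [simp]: "relu (upper z k) = upper z k"
  by (simp add: upper_def)

lemma relu_exp_interp [simp]: "relu (exp_interp h t) = exp_interp h t"
  using exp_interp_pos[OF h_pos, of t] by simp

text \<open>Registers of the network: \<open>0\<close> holds the folded argument on the way down; on the way up
  \<open>0\<close>, \<open>1\<close>, \<open>2\<close> hold the interpolants at \<open>\<plusminus>\<close> the folded argument and the gap. Register \<open>k + 3\<close>
  remembers on which side of the \<open>k\<close>-th crease the argument was.\<close>

definition down_state :: "real \<Rightarrow> nat \<Rightarrow> nat \<Rightarrow> real" where
  "down_state z k i = (if i = 0 then folded z k else if 3 \<le> i \<and> i \<le> k + 3 then upper z (i - 3) else 0)"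

definition up_state :: "real \<Rightarrow> nat \<Rightarrow> nat \<Rightarrow> real" where
  "up_state z k i =
    (if i = 0 then exp_interp h (folded z (Suc k)) else if i = 1 then exp_interp h (- folded z (Suc k))
     else if i = 2 then gap z k else upper z (i - 3))"

definition input_layer :: "real \<Rightarrow> real mat \<times> real Matrix.vec" where
  "input_layer \<epsilon> = sparse_layer (m + 3) 1
     (\<lambda>i. if i = 0 \<or> i = 3 then [(0, - 1 / \<epsilon>)] else [])
     (\<lambda>i. if i = 0 then extent else if i = 3 then extent - crease 0 else 0)"

text \<open>Rows 0 and \<open>k + 4\<close> share the formula for the next folded value; the latter
  also subtracts the next crease. For \<open>k = m - 1\<close> the row \<open>k + 4\<close> lies
  outside the vector.\<close>

definition down_layer :: "nat \<Rightarrow> real mat \<times> real Matrix.vec" where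
  "down_layer k = sparse_layer (m + 3) (m + 3)
     (\<lambda>i. if i = 0 \<or> i = k + 4 then [(k + 3, 2), (0, - 1)] else if 3 \<le> i \<and> i \<le> k + 3 then [(i, 1)] else [])
     (\<lambda>i. if i = 0 then crease k else if i = k + 4 then crease k - crease (Suc k) else 0)"

text \<open>On the first cell E(w) and E(-w) are affine in w. Their constants 1 cancel in row 2,
  which forms the innermost gap.\<close>

definition turn_layer :: "real mat \<times> real Matrix.vec" where
  "turn_layer = sparse_layer (m + 3) (m + 3)
     (\<lambda>i. if i = 0 then [(0, (exp h - 1) / h)] else if i = 1 then [(0, (exp (- h) - 1) / h)]
       else if i = 2 then [(0, (exp h - 1) / h - (exp (- h) - 1) / h), (m + 2, - steep)] else [(i, 1)])
     (\<lambda>i. if i \<le> 1 then 1 else 0)"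

text \<open>Rows 0 and 1 unfold at crease \<open>Suc k\<close>. Row 2 substitutes these two
  expressions into the gap at crease \<open>k\<close>, so unfolding and the next gap share one
  layer.\<close>

definition up_layer :: "nat \<Rightarrow> real mat \<times> real Matrix.vec" where
  "up_layer k = (let a = exp (crease (Suc k)); b = exp (- crease (Suc k)) in sparse_layer (m + 3) (m + 3)
     (\<lambda>i. if i = 0 then [(0, a), (2, - a)] else if i = 1 then [(1, b), (2, b)]
       else if i = 2 then [(0, a), (1, - b), (2, - a - b), (k + 3, - steep)] else [(i, 1)])
     (\<lambda>_. 0))"

text \<open>Merges the last unfolding, at crease 0, with the scaling by
  \<open>exp (- extent)\<close>.\<close>

definition output_layer :: "real mat \<times> real Matrix.vec" where
  "output_layer = sparse_layer 1 (m + 3)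
     (\<lambda>_. [(0, exp (crease 0 - extent)), (2, - exp (crease 0 - extent))]) (\<lambda>_. 0)"

definition net :: "real \<Rightarrow> network" where
  "net \<epsilon> = ((([input_layer \<epsilon>] @ map down_layer [0..<m]) @ [turn_layer]) @ map up_layer (rev [0..<m - 1]))
     @ [output_layer]"

section \<open>Each layer advances the registers\<close>

lemma input_layer_state:
  "map_vec relu (apply_layer (input_layer \<epsilon>) (Matrix.vec 1 (\<lambda>_. x)))
    = Matrix.vec (m + 3) (down_state (relu (extent - x / \<epsilon>)) 0)"
  unfolding input_layer_def
  \<comment> \<open>Register 3 skips the inner clipping: max 0 (max 0 y - b) = max 0 (y - b) for b
    \<ge> 0.\<close>
  by (rule relu_sparse_layer)
    (use crease_nonneg[of 0] in \<open>auto simp: down_state_def upper_def relu_def split: if_splits\<close>)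

lemma down_layer_state:
  assumes "0 \<le> z" "k < m"
  shows "map_vec relu (apply_layer (down_layer k) (Matrix.vec (m + 3) (down_state z k)))
    = Matrix.vec (m + 3) (down_state z (Suc k))"
  unfolding down_layer_def
proof (rule relu_sparse_layer)
  fix i assume i: "i < m + 3"
  consider "i = 0" | "i = k + 4" | "3 \<le> i" "i \<le> k + 3" | "i > k + 4" | "i \<in> {1, 2}" by fastforce
  then show "relu ((\<Sum>(j, a)\<leftarrow>(if i = 0 \<or> i = k + 4 then [(k + 3, 2), (0, - 1)]
        else if 3 \<le> i \<and> i \<le> k + 3 then [(i, 1)] else []). a * down_state z k j)
      + (if i = 0 then crease k else if i = k + 4 then crease k - crease (Suc k) else 0))
    = down_state z (Suc k) i"
  proof cases
    case 1
    then show ?thesis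
      using folded_Suc[of z k] folded_nonneg[OF assms(1), of "Suc k"]
      by (simp add: down_state_def del: folded.simps)
  next
    case 2
    then show ?thesis
      by (simp add: down_state_def upper_def[of z "Suc k"] folded_Suc algebra_simps del: folded.simps)
  qed (auto simp: down_state_def)
qed (use assms in \<open>auto split: if_splits\<close>)

text \<open>The index drops to \<open>m - 1\<close> because \<open>up_state z k\<close> describes
  the values after \<open>k + 1\<close> folds.\<close>

lemma turn_layer_state:
  assumes "0 \<le> z" "z \<le> extent"
  shows "map_vec relu (apply_layer turn_layer (Matrix.vec (m + 3) (down_state z m)))
    = Matrix.vec (m + 3) (up_state z (m - 1))"
proof -
  let ?w = "folded z m"
  have w: "0 \<le> ?w" "?w \<le> h"
    using folded_nonneg[OF assms(1)] folded_le[OF assms, of m] by auto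
  note E = exp_interp_pos_cell[OF h_pos w] exp_interp_neg_cell[OF h_pos w]
  have S: "Suc (m - Suc 0) = m" using m_pos by simp
  show ?thesis
    unfolding turn_layer_def
  proof (rule relu_sparse_layer)
    fix i assume i: "i < m + 3"
    consider "i = 0" | "i = 1" | "i = 2" | "3 \<le> i" by linarith
    then show "relu ((\<Sum>(j, a)\<leftarrow>(if i = 0 then [(0, (exp h - 1) / h)]
          else if i = 1 then [(0, (exp (- h) - 1) / h)]
          else if i = 2 then [(0, (exp h - 1) / h - (exp (- h) - 1) / h), (m + 2, - steep)]
          else [(i, 1)]). a * down_state z m j) + (if i \<le> 1 then 1 else 0)) = up_state z (m - 1) i"
    proof cases
      case 1
      then show ?thesis
        using relu_exp_interp[of ?w] by (simp add: down_state_def up_state_def S E del: folded.simps)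
    next
      case 2
      then show ?thesis
        using relu_exp_interp[of "- ?w"] by (simp add: down_state_def up_state_def S E del: folded.simps)
    next
      case 3
      have "down_state z m (m + 2) = upper z (m - 1)" using m_pos by (simp add: down_state_def)
      moreover have "down_state z m 0 = ?w" by (simp add: down_state_def)
      ultimately show ?thesis
        using 3 by (simp add: up_state_def gap_def S E left_diff_distrib del: folded.simps)
    next
      case 4
      then show ?thesis using i by (auto simp: down_state_def up_state_def)
    qed
  qed (auto split: if_splits)
qed

lemma up_layer_state:
  assumes "0 \<le> z" "z \<le> extent" "Suc k < m"
  shows "map_vec relu (apply_layer (up_layer k) (Matrix.vec (m + 3) (up_state z (Suc k))))
    = Matrix.vec (m + 3) (up_state z k)"
proof -
  let ?a = "exp (crease (Suc k))" and ?b = "exp (- crease (Suc k))"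
  note E = unfold_step[OF assms]
  show ?thesis
    unfolding up_layer_def Let_def
  proof (rule relu_sparse_layer)
    fix i assume i: "i < m + 3"
    consider "i = 0" | "i = 1" | "i = 2" | "3 \<le> i" by linarith
    then show "relu ((\<Sum>(j, c)\<leftarrow>(if i = 0 then [(0, ?a), (2, - ?a)] else if i = 1 then [(1, ?b), (2, ?b)]
          else if i = 2 then [(0, ?a), (1, - ?b), (2, - ?a - ?b), (k + 3, - steep)]
          else [(i, 1)]). c * up_state z (Suc k) j) + 0) = up_state z k i"
    proof cases
      case 1
      then show ?thesis
        using relu_exp_interp[of "folded z (Suc k)"]
        by (simp add: up_state_def E right_diff_distrib del: folded.simps)
    next
      case 2
      then show ?thesis
        using relu_exp_interp[of "- folded z (Suc k)"]
        by (simp add: up_state_def E distrib_left del: folded.simps)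
    next
      case 3
      then show ?thesis
        by (simp add: up_state_def gap_def[of z k] E algebra_simps del: folded.simps)
    next
      case 4
      then show ?thesis by (simp add: up_state_def)
    qed
  qed (use assms in \<open>auto split: if_splits\<close>)
qed

lemma down_layers_state:
  assumes "0 \<le> z" "k \<le> m"
  shows "hidden_layers relu (map down_layer [0..<k]) (Matrix.vec (m + 3) (down_state z 0))
    = Matrix.vec (m + 3) (down_state z k)"
  using assms(2) by (induction k) (simp_all add: down_layer_state[OF assms(1)])

lemma up_layers_state:
  assumes "0 \<le> z" "z \<le> extent" "k < m"
  shows "hidden_layers relu (map up_layer (rev [0..<k])) (Matrix.vec (m + 3) (up_state z k))
    = Matrix.vec (m + 3) (up_state z 0)"
  using assms(3) by (induction k) (simp_all add: up_layer_state[OF assms(1,2)])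

text \<open>The transitions compose. Since \<open>x \<ge> 0\<close>, the clipped argument stays
  below \<open>extent\<close>, where the folds end in the first cell.\<close>

lemma relu_fun_net:
  assumes "\<epsilon> > 0" "x \<ge> 0"
  shows "relu_fun (net \<epsilon>) x = exp (- extent) * exp_interp h (relu (extent - x / \<epsilon>))"
proof -
  define z where "z = relu (extent - x / \<epsilon>)"
  have z: "0 \<le> z" "z \<le> extent"
    using assms h_pos by (auto simp: z_def relu_def extent_def)
  have "realization relu (net \<epsilon>) (Matrix.vec 1 (\<lambda>_. x))
      = apply_layer output_layer (Matrix.vec (m + 3) (up_state z 0))"
    using up_layers_state[OF z, of "m - 1"] m_pos
    unfolding net_def realization_snoc
    by (simp add: input_layer_state z_def[symmetric] down_layers_state[OF z(1)] turn_layer_state[OF z]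
        del: One_nat_def)
  also have "\<dots> = Matrix.vec 1 (\<lambda>_. exp (crease 0 - extent) * up_state z 0 0 - exp (crease 0 - extent) * up_state z 0 2)"
    unfolding output_layer_def by (subst apply_sparse_layer) auto
  finally show ?thesis
    using unfold_step(1)[OF z m_pos]
    by (simp add: relu_fun_def up_state_def z_def[symmetric] exp_diff exp_minus field_simps del: folded.simps(2))
qed

section \<open>Shape, depth and size of the network\<close>

lemma is_network_net: "is_network 1 1 (net \<epsilon>)"
proof -
  have "is_network 1 (m + 3) [input_layer \<epsilon>]"
    unfolding input_layer_def by (rule is_network_sparse_layer) auto
  then have "is_network 1 (m + 3) ([input_layer \<epsilon>] @ map down_layer [0..<m])"
    unfolding down_layer_def by (rule is_network_append_map_sparse_layer) simp
  then have "is_network 1 (m + 3) (([input_layer \<epsilon>] @ map down_layer [0..<m]) @ [turn_layer])"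
    unfolding turn_layer_def by (rule is_network_snoc_sparse_layer) simp
  then have "is_network 1 (m + 3) ((([input_layer \<epsilon>] @ map down_layer [0..<m]) @ [turn_layer]) @ map up_layer (rev [0..<m - 1]))"
    unfolding up_layer_def Let_def by (rule is_network_append_map_sparse_layer) simp
  then show ?thesis
    unfolding net_def output_layer_def by (rule is_network_snoc_sparse_layer) simp
qed

lemma depth_net: "depth (net \<epsilon>) = 2 * m + 2"
  using m_pos by (simp add: depth_def net_def)

text \<open>No row has more than four weights, so with the bias each of the \<open>2 * m + 2\<close>
  layers costs at most \<open>(m + 3) * 5\<close>.\<close>

lemma network_size_net: "network_size (net \<epsilon>) \<le> (2 * m + 2) * ((m + 3) * 5)"
proof -
  have "network_size [input_layer \<epsilon>] \<le> (m + 3) * (4 + 1)"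
    unfolding input_layer_def by (rule network_size_sparse_layer) simp
  moreover have "network_size (map down_layer [0..<m]) \<le> length [0..<m] * ((m + 3) * (4 + 1))"
    by (rule network_size_map_le, unfold down_layer_def, rule network_size_sparse_layer) simp
  moreover have "network_size [turn_layer] \<le> (m + 3) * (4 + 1)"
    unfolding turn_layer_def by (rule network_size_sparse_layer) simp
  moreover have "network_size (map up_layer (rev [0..<m - 1])) \<le> length (rev [0..<m - 1]) * ((m + 3) * (4 + 1))"
    by (rule network_size_map_le, unfold up_layer_def Let_def, rule network_size_sparse_layer) simp
  moreover have "network_size [output_layer] \<le> 1 * (4 + 1)"
    unfolding output_layer_def by (rule network_size_sparse_layer) simp
  ultimately have "network_size (net \<epsilon>)
      \<le> (m + 3) * 5 + m * ((m + 3) * 5) + (m + 3) * 5 + (m - 1) * ((m + 3) * 5) + 1 * ((m + 3) * 5)"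
    unfolding net_def network_size_append by simp
  also have "\<dots> = (1 + m + 1 + (m - 1) + 1) * ((m + 3) * 5)"
    by (simp only: distrib_right mult_1)
  also have "1 + m + 1 + (m - 1) + 1 = 2 * m + 2" using m_pos by simp
  finally show ?thesis .
qed

end

section \<open>Error bounds\<close>

lemma nn_integral_lebesgue_on:
  assumes "S \<in> sets lebesgue"
  shows "(\<integral>\<^sup>+x. f x \<partial>lebesgue_on S) = (\<integral>\<^sup>+x. f x * indicator S x \<partial>lborel)"
  using assms by (simp add: nn_integral_restrict_space nn_integral_completion)

lemma borel_measurable_lebesgue_onI:
  "f \<in> borel_measurable borel \<Longrightarrow> f \<in> borel_measurable (lebesgue_on S)"
  by (simp add: measurable_completion measurable_restrict_space1)

lemma L2_norm_le:
  assumes "f \<in> borel_measurable (lebesgue_on S)" "0 \<le> c"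
    and "(\<integral>\<^sup>+x. ennreal ((f x)\<^sup>2) \<partial>lebesgue_on S) \<le> ennreal (c\<^sup>2)"
  shows "L2_norm S f \<le> ennreal c"
proof -
  let ?I = "\<integral>\<^sup>+x. ennreal ((f x)\<^sup>2) \<partial>lebesgue_on S"
  have "?I < \<infinity>" using assms(3) by (simp add: le_less_trans[OF _ ennreal_less_top])
  moreover have "enn2real ?I \<le> c\<^sup>2" using assms(3) by (intro enn2real_leI) auto
  then have "sqrt (enn2real ?I) \<le> c" using assms(2) by (simp add: real_le_lsqrt)
  ultimately show ?thesis using assms(1) by (simp add: L2_norm_def ennreal_leI)
qed

lemma Linf_norm_le:
  assumes "f \<in> borel_measurable (lebesgue_on S)" "\<And>x. x \<in> S \<Longrightarrow> \<bar>f x\<bar> \<le> c"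
  shows "Linf_norm S f \<le> ennreal c"
proof -
  have "esssup (lebesgue_on S) (\<lambda>x. ennreal \<bar>f x\<bar>) \<le> ennreal c"
    using assms by (intro esssup_I AE_I2) (auto intro: ennreal_leI)
  then show ?thesis using assms(1) by (simp add: Linf_norm_def)
qed

text \<open>The antiderivative is \<open>- \<epsilon> * exp (- (x / \<epsilon>))\<close>. The value
  \<epsilon> is what balances the weight in the derivative estimate.\<close>

lemma nn_integral_exp_atLeast:
  assumes "\<epsilon> > 0"
  shows "(\<integral>\<^sup>+x. ennreal (exp (- (x / \<epsilon>))) * indicator {0..} x \<partial>lborel) = ennreal \<epsilon>"
proof -
  have "filterlim (\<lambda>x. x / \<epsilon>) at_top at_top"
    using filterlim_tendsto_pos_mult_at_top[OF tendsto_const[of "1 / \<epsilon>"] _ filterlim_ident] assms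
    by simp
  then have "filterlim (\<lambda>x. - (x / \<epsilon>)) at_bot at_top"
    by (simp add: filterlim_uminus_at_top)
  then have "((\<lambda>x. exp (- (x / \<epsilon>))) \<longlongrightarrow> 0) at_top"
    by (rule filterlim_compose[OF exp_at_bot])
  then have "((\<lambda>x. - \<epsilon> * exp (- (x / \<epsilon>))) \<longlongrightarrow> - \<epsilon> * 0) at_top"
    by (intro tendsto_intros)
  then have lim: "((\<lambda>x. - \<epsilon> * exp (- (x / \<epsilon>))) \<longlongrightarrow> 0) at_top" by simp
  have "(\<integral>\<^sup>+x. ennreal (exp (- (x / \<epsilon>))) * indicator {0..} x \<partial>lborel)
      = ennreal (0 - (- \<epsilon> * exp (- (0 / \<epsilon>))))"
    by (rule nn_integral_FTC_atLeast[OF _ _ _ lim])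
      (use assms in \<open>auto intro!: derivative_eq_intros simp: field_simps\<close>)
  then show ?thesis by simp
qed

lemma borel_measurable_relu [measurable]: "relu \<in> borel_measurable borel"
  unfolding relu_def[abs_def] by measurable

lemma borel_measurable_exp_interp [measurable]: "exp_interp h \<in> borel_measurable borel"
  unfolding exp_interp_def[abs_def] frac_def by measurable

lemma borel_measurable_exp_interp_slope [measurable]: "exp_interp_slope h \<in> borel_measurable borel"
  unfolding exp_interp_slope_def[abs_def] by measurable

section \<open>Errors of the network and of its derivative\<close>

context folding
begin

text \<open>An explicit Borel representative of the weak derivative on the positive half
  line.\<close>

definition net_slope :: "real \<Rightarrow> real \<Rightarrow> real" where
  "net_slope \<epsilon> x =
     (if x / \<epsilon> < extent then - (1 / \<epsilon>) * (exp (- extent) * exp_interp_slope h (extent - x / \<epsilon>)) else 0)"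

text \<open>Before the cutoff the relative error of E is multiplied by exp(-x/\<epsilon>) \<le> 1.
  Beyond it the network is constantly \<open>exp (- extent)\<close>, and the target lies between 0
  and that value.\<close>

lemma net_error:
  assumes "\<epsilon> > 0" "x \<ge> 0" "exp h - 1 \<le> \<delta>" "exp (- extent) \<le> \<delta>"
  shows "\<bar>exp (- x / \<epsilon>) - relu_fun (net \<epsilon>) x\<bar> \<le> \<delta>"
proof (cases "x / \<epsilon> \<le> extent")
  case True
  let ?t = "extent - x / \<epsilon>"
  have e: "exp (- x / \<epsilon>) = exp (- extent) * exp ?t" by (simp add: exp_add[symmetric])
  have "\<bar>exp (- x / \<epsilon>) - relu_fun (net \<epsilon>) x\<bar> = exp (- extent) * \<bar>exp_interp h ?t - exp ?t\<bar>"
    using True by (simp only: relu_fun_net[OF assms(1,2)] e right_diff_distrib[symmetric] abs_mult)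
      (simp add: abs_minus_commute)
  also have "\<dots> \<le> exp (- extent) * (exp ?t * (exp h - 1))"
    by (intro mult_left_mono exp_interp_error h_pos) simp
  also have "\<dots> = exp (- x / \<epsilon>) * (exp h - 1)" by (simp only: e mult.assoc)
  also have "\<dots> \<le> 1 * (exp h - 1)"
    by (intro mult_right_mono) (use assms h_pos in auto)
  finally show ?thesis using assms by simp
next
  case False
  then have "relu_fun (net \<epsilon>) x = exp (- extent)"
    by (simp add: relu_fun_net[OF assms(1,2)] relu_def exp_interp_def)
  moreover have "exp (- x / \<epsilon>) \<le> exp (- extent)" using False by simp
  moreover have "0 < exp (- x / \<epsilon>)" by simp
  ultimately show ?thesis using assms(4) by linarith
qed

lemma deriv_net:
  assumes \<epsilon>: "\<epsilon> > 0" and x: "x > 0" and t: "(extent - x / \<epsilon>) / h \<notin> \<int>"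
  shows "deriv (relu_fun (net \<epsilon>)) x = net_slope \<epsilon> x"
proof -
  define t where "t = extent - x / \<epsilon>"
  \<comment> \<open>The clipping point is itself a grid point, so avoiding the grid also avoids the
    kink of the outer ReLU.\<close>
  have ne: "t \<noteq> 0" using t by (auto simp: t_def)
  show ?thesis
  proof (cases "t > 0")
    case True
    have "((\<lambda>y. exp (- extent) * exp_interp h (extent - y / \<epsilon>)) has_real_derivative net_slope \<epsilon> x) (at x)"
    proof -
      have "(exp_interp h has_real_derivative exp_interp_slope h t) (at (extent - x / \<epsilon>))"
        using exp_interp_has_derivative[OF h_pos, of t] t by (simp add: t_def)
      moreover have "((\<lambda>y. extent - y / \<epsilon>) has_real_derivative - (1 / \<epsilon>)) (at x)"
        using \<epsilon> by (auto intro!: derivative_eq_intros)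
      ultimately have "((\<lambda>y. exp_interp h (extent - y / \<epsilon>)) has_real_derivative
          exp_interp_slope h t * - (1 / \<epsilon>)) (at x)"
        by (rule DERIV_chain2)
      from DERIV_cmult[OF this, of "exp (- extent)"] show ?thesis
        using True by (simp add: net_slope_def t_def mult_ac)
    qed
    moreover have "open {y. 0 < y \<and> 0 < extent - y / \<epsilon>}"
      by (intro open_Collect_conj open_Collect_less continuous_intros) (use \<epsilon> in auto)
    ultimately have "(relu_fun (net \<epsilon>) has_real_derivative net_slope \<epsilon> x) (at x)"
      by (rule has_field_derivative_transform_within_open)
        (use True x \<epsilon> in \<open>auto simp: t_def relu_fun_net\<close>)
    then show ?thesis by (rule DERIV_imp_deriv)
  next
    case False
    then have "t < 0" using ne by simp
    moreover have "open {y. 0 < y \<and> extent - y / \<epsilon> < 0}"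
      by (intro open_Collect_conj open_Collect_less continuous_intros) (use \<epsilon> in auto)
    ultimately have "(relu_fun (net \<epsilon>) has_real_derivative 0) (at x)"
      by (intro has_field_derivative_transform_within_open[OF DERIV_const[of "exp (- extent)"],
            of "{y. 0 < y \<and> extent - y / \<epsilon> < 0}"])
        (use x \<epsilon> in \<open>auto simp: t_def relu_fun_net relu_def exp_interp_def\<close>)
    then show ?thesis
      using \<open>t < 0\<close> by (simp add: net_slope_def t_def DERIV_imp_deriv)
  qed
qed

lemma AE_deriv_net:
  assumes "\<epsilon> > 0"
  shows "AE x in lborel. 0 < x \<longrightarrow> deriv (relu_fun (net \<epsilon>)) x = net_slope \<epsilon> x"
proof -
  let ?N = "(\<lambda>n. \<epsilon> * (extent - n * h)) ` (\<int> :: real set)"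
  have "countable (\<int> :: real set)" by (simp add: Ints_def)
  then have "?N \<in> null_sets lborel" by (intro countable_imp_null_set_lborel) simp
  then have "AE x in lborel. x \<notin> ?N" by (rule AE_not_in)
  then show ?thesis
  proof (rule AE_mp, intro AE_I2 impI)
    fix x :: real
    assume N: "x \<notin> ?N" and x: "0 < x"
    \<comment> \<open>Solved for \<open>x\<close>, an integer grid coordinate would place
      \<open>x\<close> in the countable exceptional set.\<close>
    have "x = \<epsilon> * (extent - (extent - x / \<epsilon>) / h * h)"
      using assms h_pos by (simp add: field_simps)
    then have "(extent - x / \<epsilon>) / h \<notin> \<int>" using N by blast
    then show "deriv (relu_fun (net \<epsilon>)) x = net_slope \<epsilon> x"
      by (rule deriv_net[OF assms x])
  qed
qed

text \<open>Giving away half of the exponent keeps the tail beyond \<open>extent\<close> square integrable with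
  the right scaling in \<open>\<epsilon>\<close>.\<close>

lemma net_slope_error:
  assumes "\<epsilon> > 0" "x \<ge> 0" "exp h - 1 \<le> \<delta>" "exp (- extent / 2) \<le> \<delta>"
  shows "\<bar>- (1 / \<epsilon>) * exp (- x / \<epsilon>) - net_slope \<epsilon> x\<bar> \<le> \<delta> / \<epsilon> * exp (- x / \<epsilon> / 2)"
proof (cases "x / \<epsilon> < extent")
  case True
  let ?t = "extent - x / \<epsilon>"
  have e: "exp (- x / \<epsilon>) = exp (- extent) * exp ?t" by (simp add: exp_add[symmetric])
  have "- (1 / \<epsilon>) * exp (- x / \<epsilon>) - net_slope \<epsilon> x
      = 1 / \<epsilon> * exp (- extent) * (exp_interp_slope h ?t - exp ?t)"
    using True by (simp only: net_slope_def e if_True) (simp add: algebra_simps)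
  then have "\<bar>- (1 / \<epsilon>) * exp (- x / \<epsilon>) - net_slope \<epsilon> x\<bar>
      = 1 / \<epsilon> * exp (- extent) * \<bar>exp_interp_slope h ?t - exp ?t\<bar>"
    using assms(1) by (simp only: abs_mult) simp
  also have "\<dots> \<le> 1 / \<epsilon> * exp (- extent) * (exp ?t * (exp h - 1))"
    by (intro mult_left_mono exp_interp_slope_error h_pos) (use assms in simp)
  also have "\<dots> = 1 / \<epsilon> * (exp (- x / \<epsilon>) * (exp h - 1))" by (simp only: e mult.assoc)
  also have "\<dots> \<le> 1 / \<epsilon> * (exp (- x / \<epsilon> / 2) * \<delta>)"
    by (intro mult_left_mono mult_mono) (use assms h_pos in \<open>auto simp: field_simps\<close>)
  finally show ?thesis by (simp add: mult_ac)
next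
  case False
  have "exp (- x / \<epsilon>) = exp (- x / \<epsilon> / 2) * exp (- x / \<epsilon> / 2)"
    by (simp add: exp_add[symmetric])
  also have "\<dots> \<le> exp (- x / \<epsilon> / 2) * \<delta>"
    by (intro mult_left_mono order_trans[OF _ assms(4)]) (use False in auto)
  finally have "1 / \<epsilon> * exp (- x / \<epsilon>) \<le> 1 / \<epsilon> * (exp (- x / \<epsilon> / 2) * \<delta>)"
    by (intro mult_left_mono) (use assms in auto)
  then show ?thesis using False assms(1) by (simp add: net_slope_def abs_mult mult_ac)
qed

lemma borel_measurable_net_slope: "net_slope \<epsilon> \<in> borel_measurable borel"
  unfolding net_slope_def[abs_def] by measurable

lemma borel_measurable_net_error:
  assumes "\<epsilon> > 0"
  shows "(\<lambda>x. exp (- x / \<epsilon>) - relu_fun (net \<epsilon>) x) \<in> borel_measurable (lebesgue_on {0<..<1})"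
proof -
  have "(\<lambda>x. exp (- x / \<epsilon>) - exp (- extent) * exp_interp h (relu (extent - x / \<epsilon>)))
      \<in> borel_measurable (lebesgue_on {0<..<1})"
    by (rule borel_measurable_lebesgue_onI) measurable
  then show ?thesis
    by (rule measurable_cong[THEN iffD1, rotated]) (use assms in \<open>auto simp: relu_fun_net\<close>)
qed

text \<open>Measurability of \<open>deriv\<close> comes from almost everywhere equality with the
  Borel function \<open>net_slope\<close>, by completeness of Lebesgue measure.\<close>

lemma borel_measurable_deriv_net_error:
  assumes "\<epsilon> > 0"
  shows "(\<lambda>x. - (1 / \<epsilon>) * exp (- x / \<epsilon>) - deriv (relu_fun (net \<epsilon>)) x) \<in> borel_measurable (lebesgue_on {0<..<1})"
proof -
  \<comment> \<open>Gluing in \<open>net_slope\<close> on the nonpositive side makes the equality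
    hold almost everywhere on the whole line.\<close>
  let ?g = "\<lambda>x. if 0 < x then deriv (relu_fun (net \<epsilon>)) x else net_slope \<epsilon> x"
  have ae: "AE x in lebesgue. net_slope \<epsilon> x = ?g x"
    by (rule AE_completion, rule AE_mp[OF AE_deriv_net[OF assms]]) (auto intro!: AE_I2)
  have "net_slope \<epsilon> \<in> borel_measurable lebesgue"
    using borel_measurable_net_slope by (simp add: measurable_completion)
  from borel_measurable_AE[OF this ae] have "?g \<in> borel_measurable (lebesgue_on {0<..<1})"
    by (rule measurable_restrict_space1)
  moreover have "(\<lambda>x. - (1 / \<epsilon>) * exp (- x / \<epsilon>)) \<in> borel_measurable (lebesgue_on {0<..<1})"
    by (rule borel_measurable_lebesgue_onI) measurable
  ultimately have "(\<lambda>x. - (1 / \<epsilon>) * exp (- x / \<epsilon>) - ?g x) \<in> borel_measurable (lebesgue_on {0<..<1})"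
    by (intro borel_measurable_diff)
  then show ?thesis
    by (rule measurable_cong[THEN iffD1, rotated]) auto
qed

lemma Linf_norm_net_error:
  assumes "\<epsilon> > 0" "exp h - 1 \<le> \<delta>" "exp (- extent) \<le> \<delta>"
  shows "Linf_norm {0<..<1} (\<lambda>x. exp (- x / \<epsilon>) - relu_fun (net \<epsilon>) x) \<le> ennreal \<delta>"
  by (rule Linf_norm_le[OF borel_measurable_net_error[OF assms(1)] net_error[OF assms(1) _ assms(2,3)]])
    simp

text \<open>The interval has measure 1, so the uniform bound is also a bound in L2.\<close>

lemma L2_norm_net_error:
  assumes "\<epsilon> > 0" "exp h - 1 \<le> \<delta>" "exp (- extent) \<le> \<delta>"
  shows "L2_norm {0<..<1} (\<lambda>x. exp (- x / \<epsilon>) - relu_fun (net \<epsilon>) x) \<le> ennreal \<delta>"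
proof (rule L2_norm_le[OF borel_measurable_net_error])
  show "0 \<le> \<delta>" using assms(2) h_pos by (smt (verit) one_le_exp_iff)
  have "(\<integral>\<^sup>+x. ennreal ((exp (- x / \<epsilon>) - relu_fun (net \<epsilon>) x)\<^sup>2) \<partial>lebesgue_on {0<..<1})
      \<le> (\<integral>\<^sup>+(x::real). ennreal (\<delta>\<^sup>2) \<partial>lebesgue_on {0<..<1})"
  proof (intro nn_integral_mono ennreal_leI)
    fix x :: real
    assume "x \<in> space (lebesgue_on {0<..<1})"
    then show "(exp (- x / \<epsilon>) - relu_fun (net \<epsilon>) x)\<^sup>2 \<le> \<delta>\<^sup>2"
      using net_error[OF assms(1) _ assms(2,3), of x] \<open>0 \<le> \<delta>\<close> by (simp add: power2_le_iff_abs_le)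
  qed
  also have "\<dots> = ennreal (\<delta>\<^sup>2)"
    by (simp add: emeasure_restrict_space)
  finally show "(\<integral>\<^sup>+x. ennreal ((exp (- x / \<epsilon>) - relu_fun (net \<epsilon>) x)\<^sup>2) \<partial>lebesgue_on {0<..<1}) \<le> ennreal (\<delta>\<^sup>2)" .
qed fact

text \<open>Squaring the pointwise bound and integrating over the half line gives
  (\<delta>/\<epsilon>)^2 \<epsilon>. Its root times the square root of \<epsilon> is \<delta>,
  uniformly in \<epsilon>.\<close>

lemma L2_norm_deriv_net_error:
  assumes \<epsilon>: "\<epsilon> > 0" and \<delta>: "exp h - 1 \<le> \<delta>" "exp (- extent / 2) \<le> \<delta>"
  shows "ennreal (\<epsilon> powr (1 / 2)) *
      L2_norm {0<..<1} (\<lambda>x. - (1 / \<epsilon>) * exp (- x / \<epsilon>) - deriv (relu_fun (net \<epsilon>)) x) \<le> ennreal \<delta>"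
proof -
  let ?f = "\<lambda>x. - (1 / \<epsilon>) * exp (- x / \<epsilon>) - deriv (relu_fun (net \<epsilon>)) x"
  have d0: "0 \<le> \<delta>" using \<delta>(2) by (rule order_trans[rotated]) simp
  have "(\<integral>\<^sup>+x. ennreal ((?f x)\<^sup>2) \<partial>lebesgue_on {0<..<1})
      = (\<integral>\<^sup>+x. ennreal ((?f x)\<^sup>2) * indicator {0<..<1} x \<partial>lborel)"
    by (rule nn_integral_lebesgue_on) simp
  also have "\<dots> \<le> (\<integral>\<^sup>+x. ennreal ((\<delta> / \<epsilon>)\<^sup>2) * (ennreal (exp (- x / \<epsilon>)) * indicator {0..} x) \<partial>lborel)"
  proof (rule nn_integral_mono_AE, rule AE_mp[OF AE_deriv_net[OF \<epsilon>]], intro AE_I2 impI)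
    fix x :: real
    assume D: "0 < x \<longrightarrow> deriv (relu_fun (net \<epsilon>)) x = net_slope \<epsilon> x"
    show "ennreal ((?f x)\<^sup>2) * indicator {0<..<1} x
        \<le> ennreal ((\<delta> / \<epsilon>)\<^sup>2) * (ennreal (exp (- x / \<epsilon>)) * indicator {0..} x)"
    proof (cases "0 < x")
      case True
      then have "\<bar>?f x\<bar> \<le> \<delta> / \<epsilon> * exp (- x / \<epsilon> / 2)"
        using net_slope_error[OF \<epsilon> _ \<delta>, of x] D by simp
      then have "(?f x)\<^sup>2 \<le> (\<delta> / \<epsilon> * exp (- x / \<epsilon> / 2))\<^sup>2"
        using d0 \<epsilon> by (simp add: power2_le_iff_abs_le)
      also have "\<dots> = (\<delta> / \<epsilon>)\<^sup>2 * exp (- x / \<epsilon>)"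
        by (simp only: power_mult_distrib) (simp add: exp_double[symmetric])
      finally show ?thesis
        using True by (auto simp: ennreal_mult[symmetric] ennreal_leI split: split_indicator)
    qed simp
  qed
  also have "\<dots> = ennreal ((\<delta> / \<epsilon>)\<^sup>2 * \<epsilon>)"
    using \<epsilon> by (subst nn_integral_cmult) (simp_all add: nn_integral_exp_atLeast ennreal_mult)
  also have "(\<delta> / \<epsilon>)\<^sup>2 * \<epsilon> = (\<delta> / sqrt \<epsilon>)\<^sup>2"
    using \<epsilon> by (simp add: power_divide power2_eq_square)
  finally have "L2_norm {0<..<1} ?f \<le> ennreal (\<delta> / sqrt \<epsilon>)"
    using d0 \<epsilon> by (intro L2_norm_le[OF borel_measurable_deriv_net_error]) auto
  then have "ennreal (\<epsilon> powr (1 / 2)) * L2_norm {0<..<1} ?f \<le> ennreal (\<epsilon> powr (1 / 2)) * ennreal (\<delta> / sqrt \<epsilon>)"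
    by (rule mult_left_mono) simp
  also have "\<dots> = ennreal \<delta>"
    using d0 \<epsilon> by (simp add: ennreal_mult[symmetric] powr_half_sqrt)
  finally show ?thesis .
qed

end

section \<open>Choice of parameters and the final estimate\<close>

lemma two_power_ge: "real p \<le> 2 ^ p"
  using of_nat_less_two_power[of p] by (simp add: less_imp_le)

text \<open>The rate 1/2 comes from exp(1/2) \<le> 2.\<close>

lemma inverse_two_power_le_exp: "(1 / 2) ^ p \<le> exp (- (1 / 2) * real p)"
proof -
  have "exp (1 / 2) \<le> (2 :: real)" using exp_bound_half[of "1 / 2 :: real"] by simp
  then have "exp (- (1 / 2)) \<ge> (1 / 2 :: real)" by (simp add: exp_minus field_simps)
  then have "(1 / 2) ^ p \<le> exp (- (1 / 2) :: real) ^ p" by (rule power_mono) simp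
  then show ?thesis by (simp add: exp_of_nat_mult[symmetric] mult.commute)
qed

text \<open>Choosing \<open>Ct\<close> before \<open>\<kappa>\<close>, \<open>C\<close> and
  \<open>\<beta>\<close> expresses dependence on \<open>\<beta>\<close> alone. Requiring
  \<open>\<kappa>\<^sub>1 < 4 / exp 1\<close> makes the range of \<open>\<kappa>\<close>
  nonempty.\<close>

theorem proposition5p3:
  shows "\<exists>\<kappa>\<^sub>1::real. 0 < \<kappa>\<^sub>1 \<and> \<kappa>\<^sub>1 < 4 / exp 1 \<and>
    (\<exists>Ct :: real \<Rightarrow> real. (\<forall>b>0. 0 < Ct b) \<and>
      (\<forall>\<kappa>. \<kappa>\<^sub>1 < \<kappa> \<and> \<kappa> < 4 / exp 1 \<longrightarrow>
        (\<exists>C>0. \<exists>\<beta>>0. \<forall>p::nat. \<forall>\<epsilon>::real. 1 \<le> p \<and> 0 < \<epsilon> \<and> \<epsilon> \<le> 1 \<longrightarrow>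
          (\<exists>\<Phi>. is_network 1 1 \<Phi> \<and>
            ennreal (\<epsilon> powr (1/2)) *
                L2_norm {0<..<1} (\<lambda>x. - (1/\<epsilon>) * exp (- x/\<epsilon>) - deriv (relu_fun \<Phi>) x)
              \<le> ennreal (C * exp (- \<beta> * real p)) \<and>
            L2_norm {0<..<1} (\<lambda>x. exp (- x/\<epsilon>) - relu_fun \<Phi> x)
              \<le> ennreal (C * exp (- \<beta> * real p)) \<and>
            Linf_norm {0<..<1} (\<lambda>x. exp (- x/\<epsilon>) - relu_fun \<Phi> x)
              \<le> ennreal (C * exp (- \<beta> * real p)) \<and>
            real (depth \<Phi>) \<le> Ct \<beta> * real p * (1 + log 2 (real p)) \<and>
            real (network_size \<Phi>) \<le> Ct \<beta> * (real p)\<^sup>2))))"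
proof -
  have net: "\<exists>\<Phi>. is_network 1 1 \<Phi> \<and>
            ennreal (\<epsilon> powr (1/2)) *
                L2_norm {0<..<1} (\<lambda>x. - (1/\<epsilon>) * exp (- x/\<epsilon>) - deriv (relu_fun \<Phi>) x)
              \<le> ennreal (2 * exp (- (1 / 2) * real p)) \<and>
            L2_norm {0<..<1} (\<lambda>x. exp (- x/\<epsilon>) - relu_fun \<Phi> x)
              \<le> ennreal (2 * exp (- (1 / 2) * real p)) \<and>
            Linf_norm {0<..<1} (\<lambda>x. exp (- x/\<epsilon>) - relu_fun \<Phi> x)
              \<le> ennreal (2 * exp (- (1 / 2) * real p)) \<and>
            real (depth \<Phi>) \<le> 150 * real p * (1 + log 2 (real p)) \<and>
            real (network_size \<Phi>) \<le> 150 * (real p)\<^sup>2"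
    if p: "1 \<le> p" and \<epsilon>: "0 < \<epsilon>" for p :: nat and \<epsilon> :: real
  proof -
    define h :: real where "h = (1 / 2) ^ p"
    define \<delta> where "\<delta> = 2 * exp (- (1 / 2) * real p)"
    \<comment> \<open>Of the \<open>2 * p\<close> folds, \<open>p\<close> pay for the mesh 2^(-p)
      and \<open>p\<close> for the extent 2^p.\<close>
    interpret folding h "2 * p"
      by unfold_locales (use p in \<open>auto simp: h_def\<close>)
    have extent: "extent = 2 ^ p"
      unfolding extent_def by (simp add: h_def mult_2 power_add power_one_over)
    have h1: "h \<le> 1" by (simp add: h_def power_le_one)
    \<comment> \<open>The relative error is at most 2 h, which explains the factor 2 in
      \<delta>.\<close>
    have "exp h \<le> 1 + h + h\<^sup>2"
      using h_pos h1 by (intro exp_bound) auto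
    also have "h\<^sup>2 \<le> h" using h_pos h1 by (simp add: power2_eq_square mult_left_le)
    finally have "exp h - 1 \<le> 2 * h" by simp
    then have d1: "exp h - 1 \<le> \<delta>"
      using inverse_two_power_le_exp[of p] unfolding h_def \<delta>_def by linarith
    have "exp (- extent / 2) \<le> exp (- (1 / 2) * real p)"
      using two_power_ge[of p] by (simp add: extent)
    moreover have "0 < exp (- (1 / 2) * real p)" by simp
    ultimately have d2: "exp (- extent / 2) \<le> \<delta>" unfolding \<delta>_def by linarith
    have d3: "exp (- extent) \<le> \<delta>"
      by (rule order_trans[OF _ d2]) (simp add: extent)
    have "real (depth (net \<epsilon>)) \<le> 150 * real p * 1"
      using p by (simp add: depth_net)
    also have "\<dots> \<le> 150 * real p * (1 + log 2 (real p))"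
      using p by (intro mult_left_mono) auto
    finally have depth: "real (depth (net \<epsilon>)) \<le> 150 * real p * (1 + log 2 (real p))" .
    have "network_size (net \<epsilon>) \<le> (2 * (2 * p) + 2) * ((2 * p + 3) * 5)"
      by (rule network_size_net)
    \<comment> \<open>As \<open>p \<ge> 1\<close>, 4p + 2 \<le> 6p and 2p + 3 \<le> 5p; the product
      is the constant 150, which amply covers the depth 4p + 2 as well.\<close>
    also have "\<dots> \<le> (6 * p) * (5 * p * 5)"
      using p by (intro mult_mono) auto
    also have "\<dots> = 150 * p\<^sup>2" by (simp add: power2_eq_square)
    finally have "real (network_size (net \<epsilon>)) \<le> real (150 * p\<^sup>2)" by (rule of_nat_mono)
    then show ?thesis
      using is_network_net depth L2_norm_deriv_net_error[OF \<epsilon> d1 d2]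
        L2_norm_net_error[OF \<epsilon> d1 d3] Linf_norm_net_error[OF \<epsilon> d1 d3]
      unfolding \<delta>_def by (intro exI[of _ "net \<epsilon>"]) simp
  qed
  \<comment> \<open>From e \<le> 3 the threshold 1 lies below 4/e.\<close>
  have "(1::real) < 4 / exp 1" using exp_le by (simp add: field_simps)
  then show ?thesis
    using net
    by (intro exI[of _ 1] conjI exI[of _ "\<lambda>_. 150"] allI impI exI[of _ 2] exI[of _ "1 / 2"]) auto
qed

end
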